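(* The geodesic flow on $T\mathrm H_n$, where the Heisenberg Lie group $\mathrm H_n$ carries its canonical left-invariant metric, is completely integrable in the sense of Liouville. In fact the set $$\mathcal G=\{\mathrm E\}\cup\{g_{A_i}\}_{i=1}^n\cup\{F_{T_k}\}_{k=1}^n$$ is a family of commuting first integrals of the geodesic flow. Moreover, each of the sets $$\mathcal F=\{f_{Z_1}\}\cup\{g_{A_i}\}_{i=1}^n\cup\{F_{2k-1}\}_{k=1}^n,\qquad \mathcal F'=\{f_{Z_1}\}\cup\{g_{A_i}\}_{i=1}^n\cup\{F_{2k}\}_{k=1}^n$$ is an independent commuting family of first integrals of the geodesic flow.
   Context: The Heisenberg group $\mathrm H_n$ is $\mathbb R^{2n}\times\mathbb R$ with product $(v,z)(v',z')=(v+v',\,z+z'-\tfrac12 v^{\tau}Jv')$, where $J$ is multiplication by $i$ on $\mathbb R^{2n}\simeq\mathbb C^n$ ($Je_{2k-1}=e_{2k}$, $Je_{2k}=-e_{2k-1}$). Its Lie algebra $\mathfrak h_n$ has basis $X_1,\dots,X_{2n},Z_1$ with nonzero brackets $[X_{2i-1},X_{2i}]=Z_1$, $i=1,\dots,n$. The canonical metric is the left-invariant Riemannian metric $\langle\cdot,\cdot\rangle$ for which this basis is orthonormal. Put $\mathfrak v=\mathrm{span}(X_1,\dots,X_{2n})$, $\mathfrak z=\mathbb RZ_1$; subscripts $\mathfrak v,\mathfrak z$ denote orthogonal projections. On $\mathfrak v$, $JX_{2i-1}=X_{2i}$, $JX_{2i}=-X_{2i-1}$. The exponential map $\exp:\mathfrak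 h_n\to\mathrm H_n$ is a diffeomorphism; for $p\in\mathrm H_n$, $W\in\mathfrak h_n$ denotes the element with $\exp W=p$. For a Lie group $N$ with left-invariant metric and Lie algebra $\mathfrak n$ (here $N=\mathrm H_n$): $TN$ is identified with $N\times\mathfrak n$, where $(p,Y)$ stands for $dL_p(Y)$, and $T_{(p,Y)}(TN)$ with $\mathfrak n\times\mathfrak n$, where $(U,V)$ is the initial velocity of $t\mapsto(p\exp(tU),Y+tV)$; $TN$ carries the product metric, used to define gradients. The canonical symplectic form is $\Omega_{(p,Y)}((U,V),(U',V'))=\langle U,V'\rangle-\langle V,U'\rangle+\langle Y,[U,U']\rangle$; $X_f$ is defined by $df=\Omega(X_f,\cdot)$, and $\{f,g\}=\Omega(X_f,X_g)$. The energy is $\mathrm E(p,Y)=\frac12\langle Y,Y\rangle$; the geodesic flow is the Hamiltonian flow of $\mathrm E$; $f$ is a first integral if $\{f,\mathrm E\}=0$. A family of functions is commuting if all its pairwise Poisson brackets vanish, and independent if the gradients of its members are linearly independent on an open dense subset of $TN$. The geodesic flow is completely integrable (in the sense of Liouville) if there exist $\dim N$ smooth functions on $TN$ which form an independent commuting family of first integrals. Functions: $f_{Z_1}(p,Y)=\langle Y,Z_1\rangle$. For $i=1,\dots,n$, $A_iY=\langle Y,X_{2i-1}\rangle X_{2i-1}+\langle Y,X_{2i}\rangle X_{2i}$ (a symmetric map, zero on $\mathfrak z$), $g_{A_i}(p,Y)=\langle A_iY,Y\rangle$, and $T_i=JA_i:\mathfrak v\to\mathfrak v$. For $p=\exp W$: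 $$F_{T_i}(p,Y)=\langle T_iW_{\mathfrak v},Y_{\mathfrak v}\rangle-\tfrac12\langle A_iW_{\mathfrak v},W_{\mathfrak v}\rangle\langle Z_1,Y\rangle,$$ $$F_k(p,Y)=\langle Y,X_k\rangle-\langle Y,Z_1\rangle\langle JW_{\mathfrak v},X_k\rangle,\qquad k=1,\dots,2n.$$ *)

theory Defs
  imports "HOL-Analysis.Analysis"
begin

section \<open>Smooth functions\<close>

text \<open>A function is \<open>C\<^sup>k\<^sup>+\<^sup>1\<close> if it is differentiable and all its directional derivatives are \<open>C\<^sup>k\<close>;
  on a Euclidean space this is the usual notion.\<close>

primrec Ck :: "nat \<Rightarrow> ('a::euclidean_space \<Rightarrow> real) \<Rightarrow> bool" where
  "Ck 0 f \<longleftrightarrow> continuous_on UNIV f"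
| "Ck (Suc k) f \<longleftrightarrow> (\<forall>x. f differentiable at x) \<and> (\<forall>v. Ck k (\<lambda>x. frechet_derivative f (at x) v))"

definition smooth :: "('a::euclidean_space \<Rightarrow> real) \<Rightarrow> bool" where
  "smooth f \<longleftrightarrow> (\<forall>k. Ck k f)"

section \<open>The Heisenberg group and its Lie algebra\<close>

text \<open>The number \<open>n\<close> is \<open>CARD('n)\<close>, and \<open>\<real>\<^sup>2\<^sup>n\<close> is identified with \<open>\<complex>\<^sup>n\<close> by
  \<open>e\<^sub>2\<^sub>i\<^sub>-\<^sub>1 = axis i 1\<close> and \<open>e\<^sub>2\<^sub>i = axis i \<i>\<close>.  The inner product of \<open>complex ^ 'n\<close> in the library
  is the real one, for which these vectors are orthonormal.\<close>

type_synonym 'n heis = "(complex, 'n) vec \<times> real"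
type_synonym 'n heis_alg = "(complex, 'n) vec \<times> real"

definition mult_i :: "complex ^ 'n \<Rightarrow> complex ^ 'n" where
  "mult_i v = (\<chi> k. \<i> * v $ k)"

definition heis_mult :: "'n::finite heis \<Rightarrow> 'n heis \<Rightarrow> 'n heis" where
  "heis_mult p q = (fst p + fst q, snd p + snd q - 1/2 * (fst p \<bullet> mult_i (fst q)))"

definition X_odd :: "'n::finite \<Rightarrow> 'n heis_alg" where
  "X_odd i = (axis i 1, 0)"

definition X_even :: "'n::finite \<Rightarrow> 'n heis_alg" where
  "X_even i = (axis i \<i>, 0)"

definition Z1 :: "'n::finite heis_alg" where
  "Z1 = (0, 1)"

text \<open>The Lie algebra is the tangent space at the identity.  Its bracket is the alternating bilinear
  map with \<open>[X\<^sub>2\<^sub>i\<^sub>-\<^sub>1, X\<^sub>2\<^sub>i] = Z\<^sub>1\<close> whose other brackets of basis vectors vanish.\<close>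

definition heis_bracket :: "'n::finite heis_alg \<Rightarrow> 'n heis_alg \<Rightarrow> 'n heis_alg" where
  "heis_bracket U V =
     (\<Sum>i\<in>UNIV. (U \<bullet> X_odd i) * (V \<bullet> X_even i) - (U \<bullet> X_even i) * (V \<bullet> X_odd i)) *\<^sub>R Z1"

definition proj_v :: "'n::finite heis_alg \<Rightarrow> 'n heis_alg" where
  "proj_v Y = (fst Y, 0)"

text \<open>The map \<open>J\<close> lives on \<open>\<vv>\<close>; it is extended by zero to the center.\<close>

definition JJ :: "'n::finite heis_alg \<Rightarrow> 'n heis_alg" where
  "JJ Y = (mult_i (fst Y), 0)"

definition one_parameter_subgroup :: "(real \<Rightarrow> 'n::finite heis) \<Rightarrow> 'n heis_alg \<Rightarrow> bool" where
  "one_parameter_subgroup \<gamma> U \<longleftrightarrow>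
     (\<forall>s t. \<gamma> (s + t) = heis_mult (\<gamma> s) (\<gamma> t)) \<and> (\<gamma> has_vector_derivative U) (at 0)"

definition heis_exp :: "'n::finite heis_alg \<Rightarrow> 'n heis" where
  "heis_exp U = (THE \<gamma>. one_parameter_subgroup \<gamma> U) 1"

definition heis_log :: "'n::finite heis \<Rightarrow> 'n heis_alg" where
  "heis_log = inv heis_exp"

section \<open>Symplectic geometry of the tangent bundle\<close>

text \<open>The tangent bundle in its left trivialization: \<open>(p, Y)\<close> stands for \<open>dL\<^sub>p(Y)\<close>.  A tangent
  vector \<open>(U, V)\<close> at \<open>(p, Y)\<close> is the initial velocity of \<open>t \<mapsto> (p exp(tU), Y + tV)\<close>; the inner
  product of such vectors is that of the product metric, and topology and smoothness on the
  bundle are those of the underlying vector space.\<close>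

type_synonym 'n tbundle = "'n heis \<times> 'n heis_alg"
type_synonym 'n ttangent = "'n heis_alg \<times> 'n heis_alg"

definition dir_deriv :: "('n::finite tbundle \<Rightarrow> real) \<Rightarrow> 'n tbundle \<Rightarrow> 'n ttangent \<Rightarrow> real" where
  "dir_deriv f x \<xi> =
     deriv (\<lambda>t. f (heis_mult (fst x) (heis_exp (t *\<^sub>R fst \<xi>)), snd x + t *\<^sub>R snd \<xi>)) 0"

definition gradient :: "('n::finite tbundle \<Rightarrow> real) \<Rightarrow> 'n tbundle \<Rightarrow> 'n ttangent" where
  "gradient f x = (THE \<xi>. \<forall>\<eta>. dir_deriv f x \<eta> = \<xi> \<bullet> \<eta>)"

definition symplectic_form :: "'n::finite tbundle \<Rightarrow> 'n ttangent \<Rightarrow> 'n ttangent \<Rightarrow> real" where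
  "symplectic_form x \<xi> \<eta> =
     fst \<xi> \<bullet> snd \<eta> - snd \<xi> \<bullet> fst \<eta> + snd x \<bullet> heis_bracket (fst \<xi>) (fst \<eta>)"

definition ham_field :: "('n::finite tbundle \<Rightarrow> real) \<Rightarrow> 'n tbundle \<Rightarrow> 'n ttangent" where
  "ham_field f x = (THE \<xi>. \<forall>\<eta>. dir_deriv f x \<eta> = symplectic_form x \<xi> \<eta>)"

definition poisson ::
  "('n::finite tbundle \<Rightarrow> real) \<Rightarrow> ('n tbundle \<Rightarrow> real) \<Rightarrow> 'n tbundle \<Rightarrow> real" where
  "poisson f g x = symplectic_form x (ham_field f x) (ham_field g x)"

section \<open>Complete integrability\<close>

text \<open>Families are indexed, so that repeated members count with multiplicity.  Since the Poisson
  bracket only makes sense for smooth functions, smoothness is part of being a first integral.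
  The geodesic flow is the Hamiltonian flow of \<open>energy\<close>, so the notions below are
  stated for the flow of a Hamiltonian \<open>H\<close>.\<close>

definition first_integral :: "('n::finite tbundle \<Rightarrow> real) \<Rightarrow> ('n tbundle \<Rightarrow> real) \<Rightarrow> bool" where
  "first_integral H f \<longleftrightarrow> smooth f \<and> (\<forall>x. poisson f H x = 0)"

definition commuting_family :: "'i set \<Rightarrow> ('i \<Rightarrow> 'n::finite tbundle \<Rightarrow> real) \<Rightarrow> bool" where
  "commuting_family I \<phi> \<longleftrightarrow> (\<forall>i\<in>I. \<forall>j\<in>I. \<forall>x. poisson (\<phi> i) (\<phi> j) x = 0)"

definition independent_family :: "'i set \<Rightarrow> ('i \<Rightarrow> 'n::finite tbundle \<Rightarrow> real) \<Rightarrow> bool" where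
  "independent_family I \<phi> \<longleftrightarrow>
     (\<exists>D. open D \<and> closure D = UNIV \<and>
       (\<forall>x\<in>D. inj_on (\<lambda>i. gradient (\<phi> i) x) I \<and> independent ((\<lambda>i. gradient (\<phi> i) x) ` I)))"

definition commuting_first_integrals ::
  "('n::finite tbundle \<Rightarrow> real) \<Rightarrow> 'i set \<Rightarrow> ('i \<Rightarrow> 'n tbundle \<Rightarrow> real) \<Rightarrow> bool" where
  "commuting_first_integrals H I \<phi> \<longleftrightarrow> commuting_family I \<phi> \<and> (\<forall>i\<in>I. first_integral H (\<phi> i))"

definition completely_integrable :: "('n::finite tbundle \<Rightarrow> real) \<Rightarrow> bool" where
  "completely_integrable H \<longleftrightarrow>
     (\<exists>\<phi> :: nat \<Rightarrow> 'n tbundle \<Rightarrow> real.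
        commuting_first_integrals H {..<DIM('n heis)} \<phi> \<and> independent_family {..<DIM('n heis)} \<phi>)"

section \<open>The functions\<close>

definition energy :: "'n::finite tbundle \<Rightarrow> real" where
  "energy = (\<lambda>(p, Y). 1/2 * (Y \<bullet> Y))"

definition f_Z :: "'n::finite tbundle \<Rightarrow> real" where
  "f_Z = (\<lambda>(p, Y). Y \<bullet> Z1)"

definition A :: "'n::finite \<Rightarrow> 'n heis_alg \<Rightarrow> 'n heis_alg" where
  "A i Y = (Y \<bullet> X_odd i) *\<^sub>R X_odd i + (Y \<bullet> X_even i) *\<^sub>R X_even i"

definition g_A :: "'n::finite \<Rightarrow> 'n tbundle \<Rightarrow> real" where
  "g_A i = (\<lambda>(p, Y). A i Y \<bullet> Y)"

definition T :: "'n::finite \<Rightarrow> 'n heis_alg \<Rightarrow> 'n heis_alg" where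
  "T i Y = JJ (A i Y)"

definition F_T :: "'n::finite \<Rightarrow> 'n tbundle \<Rightarrow> real" where
  "F_T i = (\<lambda>(p, Y). let W = heis_log p in
     T i (proj_v W) \<bullet> proj_v Y - 1/2 * (A i (proj_v W) \<bullet> proj_v W) * (Z1 \<bullet> Y))"

text \<open>The function \<open>F\<^sub>k\<close> is \<open>F_X X\<^sub>k\<close>.\<close>

definition F_X :: "'n::finite heis_alg \<Rightarrow> 'n tbundle \<Rightarrow> real" where
  "F_X X = (\<lambda>(p, Y). Y \<bullet> X - (Y \<bullet> Z1) * (JJ (proj_v (heis_log p)) \<bullet> X))"

text \<open>The three families have one distinguished member and two members for each \<open>i = 1, \<dots>, n\<close>.\<close>

datatype 'n fam_index = First | Second 'n | Third 'n

primrec fam_G :: "'n::finite fam_index \<Rightarrow> 'n tbundle \<Rightarrow> real" where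
  "fam_G First = energy"
| "fam_G (Second i) = g_A i"
| "fam_G (Third k) = F_T k"

primrec fam_F_odd :: "'n::finite fam_index \<Rightarrow> 'n tbundle \<Rightarrow> real" where
  "fam_F_odd First = f_Z"
| "fam_F_odd (Second i) = g_A i"
| "fam_F_odd (Third k) = F_X (X_odd k)"

primrec fam_F_even :: "'n::finite fam_index \<Rightarrow> 'n tbundle \<Rightarrow> real" where
  "fam_F_even First = f_Z"
| "fam_F_even (Second i) = g_A i"
| "fam_F_even (Third k) = F_X (X_even k)"

end

theory Submission
  imports Defs
begin

text \<open>
  In these coordinates \<open>exp\<close> is the identity.  Write \<open>G = (G\<^sub>1, G\<^sub>2)\<close> for the gradient of
  \<open>f\<close> and \<open>H\<close> for that of \<open>g\<close>, and let \<open>s = \<langle>Y, Z\<^sub>1\<rangle>\<close>.  Since \<open>[U, V] = \<langle>JU, V\<rangle> Z\<^sub>1\<close>, inverting the symplectic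
  form gives \<open>X\<^sub>f = (G\<^sub>2, s J G\<^sub>2 - G\<^sub>1)\<close> and
  \<open>{f, g} = \<langle>G\<^sub>1, H\<^sub>2\<rangle> - \<langle>G\<^sub>2, H\<^sub>1\<rangle> + s \<langle>G\<^sub>2, J H\<^sub>2\<rangle>\<close>, so every bracket is a computation in a
  single complex coordinate.  For independence, the base components \<open>s J X\<^sub>k\<close> of the gradients of
  the \<open>F\<^sub>k\<close> are linearly independent where \<open>s \<noteq> 0\<close>, and the remaining gradients are
  \<open>Z\<^sub>1\<close> and \<open>2 A\<^sub>i Y\<close> in the fibre direction, which are independent where all complex coordinates
  of \<open>Y\<^sub>\<vv>\<close> are nonzero.
\<close>

section \<open>Smooth functions\<close>

text \<open>Serves the product rule, where the derivative still contains the undifferentiated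
  factors.\<close>

lemma Ck_Suc_imp: "Ck (Suc k) f \<Longrightarrow> Ck k f"
proof (induction k arbitrary: f)
  case 0
  then show ?case
    by (auto intro: differentiable_imp_continuous_on simp: differentiable_on_def differentiable_at_withinI)
next
  case (Suc k)
  then show ?case by auto
qed

lemma frechet_derivative_eq:
  "(f has_derivative f') (at x) \<Longrightarrow> frechet_derivative f (at x) = f'"
  by (metis frechet_derivative_at)

lemma Ck_const: "Ck k (\<lambda>x. c)"
  by (induction k arbitrary: c) (auto simp: frechet_derivative_eq[OF has_derivative_const])

text \<open>A linear map is its own derivative at every point, so its directional derivatives are
  constants.\<close>

lemma Ck_bounded_linear:
  assumes "bounded_linear f"
  shows "Ck k f"
proof (cases k)
  case 0
  then show ?thesis using assms by (simp add: linear_continuous_on)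
next
  case (Suc m)
  have d: "(f has_derivative f) (at x)" for x
    by (rule bounded_linear_imp_has_derivative[OF assms])
  show ?thesis unfolding Suc
    using d by (auto simp: differentiable_def frechet_derivative_eq[OF d] Ck_const)
qed

lemma Ck_add: "Ck k f \<Longrightarrow> Ck k g \<Longrightarrow> Ck k (\<lambda>x. f x + g x)"
proof (induction k arbitrary: f g)
  case 0
  then show ?case by (auto intro: continuous_on_add)
next
  case (Suc k)
  have d: "((\<lambda>x. f x + g x) has_derivative
      (\<lambda>v. frechet_derivative f (at x) v + frechet_derivative g (at x) v)) (at x)" for x
    using Suc.prems by (auto intro!: has_derivative_add simp: frechet_derivative_works[symmetric])
  then show ?case
    using Suc by (auto simp: frechet_derivative_eq[OF d] differentiable_def)
qed

lemma Ck_mult: "Ck k f \<Longrightarrow> Ck k g \<Longrightarrow> Ck k (\<lambda>x. f x * g x)"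
proof (induction k arbitrary: f g)
  case 0
  then show ?case by (auto intro: continuous_on_mult)
next
  case (Suc k)
  have d: "((\<lambda>x. f x * g x) has_derivative
      (\<lambda>v. f x * frechet_derivative g (at x) v + frechet_derivative f (at x) v * g x)) (at x)" for x
    using Suc.prems by (auto intro!: has_derivative_mult simp: frechet_derivative_works[symmetric])
  have "Ck k f" "Ck k g" using Suc.prems Ck_Suc_imp by blast+
  then show ?case
    using Suc d by (auto simp: frechet_derivative_eq[OF d] differentiable_def intro!: Ck_add)
qed

lemma smooth_const: "smooth (\<lambda>x. c)"
  by (simp add: smooth_def Ck_const)

lemma smooth_bounded_linear: "bounded_linear f \<Longrightarrow> smooth f"
  by (simp add: smooth_def Ck_bounded_linear)

lemma smooth_add: "smooth f \<Longrightarrow> smooth g \<Longrightarrow> smooth (\<lambda>x. f x + g x)"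
  by (simp add: smooth_def Ck_add)

lemma smooth_mult: "smooth f \<Longrightarrow> smooth g \<Longrightarrow> smooth (\<lambda>x. f x * g x)"
  by (simp add: smooth_def Ck_mult)

lemma smooth_diff: "smooth f \<Longrightarrow> smooth g \<Longrightarrow> smooth (\<lambda>x. f x - g x)"
  using smooth_add[of f "\<lambda>x. (-1) * g x"] smooth_mult[OF smooth_const[of "-1"], of g] by simp

lemma smooth_sum: "(\<And>i. i \<in> I \<Longrightarrow> smooth (f i)) \<Longrightarrow> smooth (\<lambda>x. \<Sum>i\<in>I. f i x)"
  by (induction I rule: infinite_finite_induct) (auto intro: smooth_const smooth_add)

section \<open>Linear independence and density\<close>

lemma independent_imageI:
  fixes f :: "'i \<Rightarrow> 'a::real_vector"
  assumes "finite I"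
    and zero: "\<And>c. (\<Sum>i\<in>I. c i *\<^sub>R f i) = 0 \<Longrightarrow> \<forall>i\<in>I. c i = 0"
  shows "inj_on f I \<and> independent (f ` I)"
proof
  show inj: "inj_on f I"
  proof (rule inj_onI, rule ccontr)
    fix i j assume ij: "i \<in> I" "j \<in> I" "f i = f j" "i \<noteq> j"
    \<comment> \<open>If \<open>f i = f j\<close>, the coefficients 1 at \<open>i\<close> and -1 at
      \<open>j\<close> give a nontrivial relation.\<close>
    let ?c = "\<lambda>k. (if k = i then 1 else 0) - (if k = j then 1 else 0) :: real"
    have "(\<Sum>k\<in>I. ?c k *\<^sub>R f k) =
        (\<Sum>k\<in>I. if k = i then f k else 0) - (\<Sum>k\<in>I. if k = j then f k else 0)"
      unfolding sum_subtractf[symmetric] by (rule sum.cong) auto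
    also have "\<dots> = 0" using ij \<open>finite I\<close> by simp
    finally show False using zero[of ?c] ij by auto
  qed
  show "independent (f ` I)"
    using \<open>finite I\<close> zero[of "_ \<circ> f"]
    by (intro independent_if_scalars_zero) (auto simp: sum.reindex[OF inj] o_def)
qed

text \<open>A proper hyperplane has empty interior.\<close>

lemma dense_hyperplane_complement:
  fixes a :: "'a::euclidean_space"
  assumes "a \<noteq> 0"
  shows "closure {x. a \<bullet> x \<noteq> 0} = UNIV"
proof -
  have "{x. a \<bullet> x \<noteq> 0} = - {x. a \<bullet> x = 0}" by auto
  then show ?thesis using assms by (simp add: closure_complement del: Collect_neg_eq)
qed

text \<open>A finite intersection of open dense sets is open and, by Baire, dense.\<close>

lemma open_dense_generic:
  fixes B :: "'a::euclidean_space set"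
  assumes "finite B" "0 \<notin> B"
  shows "open {x. \<forall>b\<in>B. b \<bullet> x \<noteq> 0} \<and> closure {x. \<forall>b\<in>B. b \<bullet> x \<noteq> 0} = UNIV"
proof -
  have eq: "{x. \<forall>b\<in>B. b \<bullet> x \<noteq> 0} = (\<Inter>b\<in>B. {x. b \<bullet> x \<noteq> 0})" by auto
  have op: "open {x. b \<bullet> x \<noteq> 0}" for b :: 'a
    by (intro open_Collect_neq continuous_intros)
  moreover have "closure {x. b \<bullet> x \<noteq> 0} = UNIV" if "b \<in> B" for b
    using that assms by (metis dense_hyperplane_complement)
  ultimately have "UNIV \<subseteq> closure (\<Inter>b\<in>B. {x. b \<bullet> x \<noteq> 0})"
    using assms(1) by (intro Baire) (auto simp: countable_finite)
  then show ?thesis unfolding eq using op assms(1) by (auto intro: open_INT)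
qed

section \<open>The exponential map\<close>

lemma mult_i_nth [simp]: "mult_i v $ k = \<i> * v $ k"
  by (simp add: mult_i_def)

lemma mult_i_scaleR [simp]: "mult_i (c *\<^sub>R v) = c *\<^sub>R mult_i v"
  by (simp add: vec_eq_iff)

lemma mult_i_axis [simp]: "mult_i (axis k a) = axis k (\<i> * a)"
  by (simp add: vec_eq_iff axis_def)

lemma inner_mult_i_skew: "v \<bullet> mult_i w = - (mult_i v \<bullet> w)"
  by (simp add: inner_vec_def inner_complex_def flip: sum_negf)

lemma inner_mult_i_self [simp]: "v \<bullet> mult_i v = 0"
  using inner_mult_i_skew[of v v] by (simp add: inner_commute)

text \<open>Additivity carries the derivative at 0 to every point; hence
  \<open>f t - t *\<^sub>R u\<close> is constant, and it vanishes at 0.\<close>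

lemma additive_has_vector_derivative_eq:
  fixes f :: "real \<Rightarrow> 'a::real_normed_vector"
  assumes add: "\<And>s t. f (s + t) = f s + f t" and d: "(f has_vector_derivative u) (at 0)"
  shows "f t = t *\<^sub>R u"
proof -
  have f0: "f 0 = 0" using add[of 0 0] by simp
  have d': "(f has_vector_derivative u) (at s)" for s
  proof -
    have "((\<lambda>t. t - s) has_vector_derivative 1) (at s)"
      by (auto intro!: derivative_eq_intros)
    then have "((\<lambda>t. f (t - s)) has_vector_derivative u) (at s)"
      using vector_diff_chain_at[of "\<lambda>t. t - s" 1 s f u] d by (simp add: o_def)
    moreover have "f t = f (t - s) + f s" for t using add[of "t - s" s] by simp
    ultimately show ?thesis
      by (metis (no_types, lifting) ext has_vector_derivative_add_const)
  qed
  have "((\<lambda>t. f t - t *\<^sub>R u) has_vector_derivative 0) (at s within UNIV)" for s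
    using d'[of s] by (auto intro!: derivative_eq_intros)
  then obtain c where "\<And>t. f t - t *\<^sub>R u = c"
    using has_vector_derivative_zero_constant[OF convex_UNIV, of "\<lambda>t. f t - t *\<^sub>R u"] by auto
  from this[of t] this[of 0] show ?thesis by (simp add: f0)
qed

text \<open>The first coordinate is additive, hence linear. The twist in the central coordinate is
  then a multiple of \<open>fst U \<bullet> mult_i (fst U) = 0\<close>, so that coordinate is
  additive too.\<close>

lemma one_parameter_subgroup_iff:
  "one_parameter_subgroup \<gamma> U \<longleftrightarrow> \<gamma> = (\<lambda>t. t *\<^sub>R U)"
proof
  assume "one_parameter_subgroup \<gamma> U"
  then have mult: "\<And>s t. \<gamma> (s + t) = heis_mult (\<gamma> s) (\<gamma> t)"
    and d: "(\<gamma> has_vector_derivative U) (at 0)"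
    by (auto simp: one_parameter_subgroup_def)
  have 1: "fst (\<gamma> t) = t *\<^sub>R fst U" for t
    by (rule additive_has_vector_derivative_eq)
      (use mult d in \<open>auto simp: heis_mult_def has_vector_derivative_def intro!: derivative_eq_intros\<close>)
  have 2: "snd (\<gamma> t) = t *\<^sub>R snd U" for t
    by (rule additive_has_vector_derivative_eq)
      (use mult d in \<open>auto simp: heis_mult_def 1 has_vector_derivative_def intro!: derivative_eq_intros\<close>)
  show "\<gamma> = (\<lambda>t. t *\<^sub>R U)" by (auto simp: fun_eq_iff prod_eq_iff 1 2)
next
  assume "\<gamma> = (\<lambda>t. t *\<^sub>R U)"
  then show "one_parameter_subgroup \<gamma> U"
    by (auto simp: one_parameter_subgroup_def heis_mult_def prod_eq_iff has_vector_derivative_def algebra_simps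
        intro!: derivative_eq_intros)
qed

lemma heis_exp_eq [simp]: "heis_exp U = U"
  by (simp add: heis_exp_def one_parameter_subgroup_iff)

lemma heis_log_eq [simp]: "heis_log p = p"
proof -
  have "heis_exp = (id :: 'a heis_alg \<Rightarrow> _)" by (simp add: fun_eq_iff)
  then show ?thesis by (simp add: heis_log_def)
qed

section \<open>Gradients and Poisson brackets\<close>

text \<open>A relational form: one witness resolves the definite descriptions in both
  \<open>gradient\<close> and \<open>ham_field\<close>.\<close>

definition has_gradient ::
  "('n::finite tbundle \<Rightarrow> real) \<Rightarrow> 'n tbundle \<Rightarrow> 'n ttangent \<Rightarrow> bool" where
  "has_gradient f x G \<longleftrightarrow> (\<forall>\<eta>. dir_deriv f x \<eta> = G \<bullet> \<eta>)"

lemma gradient_eq: "has_gradient f x G \<Longrightarrow> gradient f x = G"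
  by (simp only: has_gradient_def gradient_def vector_eq_rdot the_sym_eq_trivial)

lemma has_gradientI:
  assumes "\<And>w z v c. ((\<lambda>t. f (heis_mult (fst x) (t *\<^sub>R w, t * z), snd x + (t *\<^sub>R v, t * c)))
    has_real_derivative G \<bullet> ((w, z), (v, c))) (at 0)"
  shows "has_gradient f x G"
  unfolding has_gradient_def dir_deriv_def
  by (auto intro!: DERIV_imp_deriv assms)

text \<open>In each coordinate, Re u Im v - Im u Re v is the real inner product of iu and v.\<close>

lemma heis_bracket_eq: "heis_bracket U V = (0, mult_i (fst U) \<bullet> fst V)"
proof -
  have "(\<Sum>i\<in>UNIV. (U \<bullet> X_odd i) * (V \<bullet> X_even i) - (U \<bullet> X_even i) * (V \<bullet> X_odd i))
      = mult_i (fst U) \<bullet> fst V"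
    by (simp add: X_odd_def X_even_def inner_prod_def inner_axis inner_vec_def[of "mult_i _"]
        inner_complex_def)
  then show ?thesis by (simp add: heis_bracket_def Z1_def)
qed

text \<open>The vector representing the contraction with \<xi>; \<open>ham_field_eq\<close> inverts
  this map explicitly.\<close>

lemma symplectic_form_eq:
  "symplectic_form x \<xi> \<eta> = (snd (snd x) *\<^sub>R JJ (fst \<xi>) - snd \<xi>, fst \<xi>) \<bullet> \<eta>"
  by (simp add: symplectic_form_def heis_bracket_eq JJ_def inner_prod_def algebra_simps)

lemma ham_field_eq:
  assumes "has_gradient f x G"
  shows "ham_field f x = (snd G, snd (snd x) *\<^sub>R JJ (snd G) - fst G)"
  unfolding ham_field_def
proof (rule the_equality)
  show "\<forall>\<eta>. dir_deriv f x \<eta> =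
      symplectic_form x (snd G, snd (snd x) *\<^sub>R JJ (snd G) - fst G) \<eta>"
    using assms by (simp add: has_gradient_def symplectic_form_eq)
next
  fix \<xi> assume "\<forall>\<eta>. dir_deriv f x \<eta> = symplectic_form x \<xi> \<eta>"
  then have "\<forall>\<eta>. G \<bullet> \<eta> = (snd (snd x) *\<^sub>R JJ (fst \<xi>) - snd \<xi>, fst \<xi>) \<bullet> \<eta>"
    using assms by (simp add: has_gradient_def symplectic_form_eq)
  then have "G = (snd (snd x) *\<^sub>R JJ (fst \<xi>) - snd \<xi>, fst \<xi>)"
    by (simp only: vector_eq_rdot)
  then show "\<xi> = (snd G, snd (snd x) *\<^sub>R JJ (snd G) - fst G)"
    by (cases \<xi>) simp
qed

text \<open>The bracket is the derivative of \<open>f\<close> along the Hamiltonian field of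
  \<open>g\<close>, that is, the inner product of \<open>G\<close> with that field.\<close>

lemma poisson_eq:
  assumes "has_gradient f x G" "has_gradient g x H"
  shows "poisson f g x = fst G \<bullet> snd H - snd G \<bullet> fst H
    + snd (snd x) * (fst (snd G) \<bullet> mult_i (fst (snd H)))"
  by (simp add: poisson_def ham_field_eq[OF assms(1)] ham_field_eq[OF assms(2)]
      symplectic_form_eq inner_prod_def JJ_def algebra_simps)

lemma poisson_commute:
  assumes "has_gradient f x G" "has_gradient g x H"
  shows "poisson f g x = - poisson g f x"
  using inner_mult_i_skew[of "fst (snd G)" "fst (snd H)"]
  by (simp add: poisson_eq[OF assms] poisson_eq[OF assms(2,1)] inner_commute)

section \<open>The functions\<close>

lemma A_eq: "A i Y = (axis i (fst Y $ i), 0)"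
proof -
  have "A i Y = (Re (fst Y $ i) *\<^sub>R axis i 1 + Im (fst Y $ i) *\<^sub>R axis i \<i>, 0)"
    by (simp add: A_def X_odd_def X_even_def inner_prod_def inner_axis inner_complex_def)
  also have "\<dots> = (axis i (fst Y $ i), 0)"
    by (simp add: vec_eq_iff axis_def complex_eq_iff)
  finally show ?thesis .
qed

lemma f_Z_eq: "f_Z x = snd (snd x)"
  by (cases x) (simp add: f_Z_def Z1_def inner_prod_def)

lemma g_A_eq: "g_A i x = Re (fst (snd x) $ i) * Re (fst (snd x) $ i)
    + Im (fst (snd x) $ i) * Im (fst (snd x) $ i)"
  by (cases x) (simp add: g_A_def A_eq inner_prod_def inner_axis' inner_complex_def)

text \<open>Real and imaginary parts make the function a polynomial in real coordinates, to which
  the derivative and smoothness rules apply.\<close>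

lemma F_T_eq: "F_T i x = Re (fst (fst x) $ i) * Im (fst (snd x) $ i)
    - Im (fst (fst x) $ i) * Re (fst (snd x) $ i)
    - 1/2 * (Re (fst (fst x) $ i) * Re (fst (fst x) $ i)
      + Im (fst (fst x) $ i) * Im (fst (fst x) $ i)) * snd (snd x)"
  by (cases x) (simp add: F_T_def T_def JJ_def proj_v_def Z1_def A_eq inner_prod_def inner_axis'
      inner_complex_def)

lemma F_X_eq: "F_X (axis k a, 0) x = (fst (snd x) $ k) \<bullet> a
    - snd (snd x) * ((\<i> * fst (fst x) $ k) \<bullet> a)"
  by (cases x) (simp add: F_X_def JJ_def proj_v_def Z1_def inner_prod_def inner_axis)

section \<open>Gradients of the functions\<close>

lemma has_gradient_energy: "has_gradient energy x (0, snd x)"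
  by (rule has_gradientI)
    (auto simp: energy_def inner_prod_def inner_add_left inner_add_right inner_commute
      intro!: derivative_eq_intros)

lemma has_gradient_f_Z: "has_gradient f_Z x (0, (0, 1))"
  by (rule has_gradientI) (auto simp: f_Z_eq inner_prod_def intro!: derivative_eq_intros)

lemma has_gradient_g_A: "has_gradient (g_A i) x (0, (axis i (2 * fst (snd x) $ i), 0))"
  by (rule has_gradientI)
    (auto simp: g_A_eq inner_prod_def inner_axis' inner_complex_def intro!: derivative_eq_intros)

text \<open>The base point enters only through \<open>fst p\<close>, which moves by ordinary
  addition along the curves, so the base component is a Euclidean gradient.\<close>

lemma has_gradient_F_T:
  "has_gradient (F_T i) x
    ((axis i (- \<i> * fst (snd x) $ i - snd (snd x) *\<^sub>R fst (fst x) $ i), 0),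
     (axis i (\<i> * fst (fst x) $ i), - 1/2 * (fst (fst x) $ i \<bullet> fst (fst x) $ i)))"
  by (rule has_gradientI)
    (auto simp: F_T_eq inner_prod_def inner_axis' inner_complex_def heis_mult_def
      algebra_simps intro!: derivative_eq_intros)

lemma has_gradient_F_X:
  "has_gradient (F_X (axis k a, 0)) x
    ((axis k (snd (snd x) *\<^sub>R (\<i> * a)), 0), (axis k a, - ((\<i> * fst (fst x) $ k) \<bullet> a)))"
  by (rule has_gradientI)
    (auto simp: F_X_eq inner_prod_def inner_axis' inner_complex_def heis_mult_def
      algebra_simps intro!: derivative_eq_intros)

section \<open>Poisson brackets of the functions\<close>

lemma poisson_f_Z_energy: "poisson f_Z energy x = 0"
  by (simp add: poisson_eq[OF has_gradient_f_Z has_gradient_energy])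

lemma poisson_g_A_energy: "poisson (g_A i) energy x = 0"
  by (simp add: poisson_eq[OF has_gradient_g_A has_gradient_energy] inner_axis' inner_complex_def)

text \<open>With w and y the i-th coordinates of base point and fibre vector, the bracket is <-iy -
  sw, y> + s<iw, iy> = -s<w, y> + s<w, y>.\<close>

lemma poisson_F_T_energy: "poisson (F_T i) energy x = 0"
  by (simp add: poisson_eq[OF has_gradient_F_T has_gradient_energy] inner_prod_def inner_axis'
      inner_complex_def algebra_simps)

text \<open>The two terms s<ia, y> and s<a, iy> cancel because multiplication by i is skew.\<close>

lemma poisson_F_X_energy: "poisson (F_X (axis k a, 0)) energy x = 0"
  by (simp add: poisson_eq[OF has_gradient_F_X has_gradient_energy] inner_prod_def inner_axis'
      inner_complex_def algebra_simps)

lemma poisson_energy_self: "poisson energy energy x = 0"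
  by (simp add: poisson_eq[OF has_gradient_energy has_gradient_energy])

lemma poisson_f_Z_f_Z: "poisson f_Z f_Z x = 0"
  by (simp add: poisson_eq[OF has_gradient_f_Z has_gradient_f_Z])

lemma poisson_f_Z_g_A: "poisson f_Z (g_A i) x = 0"
  by (simp add: poisson_eq[OF has_gradient_f_Z has_gradient_g_A])

text \<open>Bracketing with \<open>f_Z\<close> only sees the central base derivative, which is zero
  here.\<close>

lemma poisson_f_Z_F_X: "poisson f_Z (F_X (axis k a, 0)) x = 0"
  by (simp add: poisson_eq[OF has_gradient_f_Z has_gradient_F_X])

lemma poisson_g_A_g_A: "poisson (g_A i) (g_A j) x = 0"
  by (cases "i = j")
    (simp_all add: poisson_eq[OF has_gradient_g_A has_gradient_g_A] inner_axis_axis inner_complex_def)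

lemma poisson_F_T_g_A: "poisson (F_T i) (g_A j) x = 0"
  by (cases "i = j")
    (simp_all add: poisson_eq[OF has_gradient_F_T has_gradient_g_A] inner_prod_def inner_axis_axis
      inner_complex_def algebra_simps)

lemma poisson_F_T_F_T: "poisson (F_T i) (F_T j) x = 0"
  by (cases "i = j")
    (simp_all add: poisson_eq[OF has_gradient_F_T has_gradient_F_T] inner_prod_def inner_axis_axis
      inner_complex_def algebra_simps)

lemma poisson_F_X_g_A: "poisson (F_X (axis k a, 0)) (g_A j) x = 0"
  by (cases "k = j")
    (simp_all add: poisson_eq[OF has_gradient_F_X has_gradient_g_A] inner_prod_def inner_axis_axis
      inner_complex_def algebra_simps)

text \<open>Distinct coordinates are orthogonal. In one coordinate, directions a and b would give
  the bracket s<ia, b>; it vanishes for a = b, but not for a = 1, b = i and s nonzero, whence the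
  separate odd and even families.\<close>

lemma poisson_F_X_F_X: "poisson (F_X (axis k a, 0)) (F_X (axis l a, 0)) x = 0"
  by (cases "k = l")
    (simp_all add: poisson_eq[OF has_gradient_F_X has_gradient_F_X] inner_prod_def inner_axis_axis
      inner_complex_def algebra_simps)

section \<open>Smoothness of the functions\<close>

lemma bounded_linear_coords:
  "bounded_linear (\<lambda>x :: 'n::finite tbundle. Re (fst (fst x) $ i))"
  "bounded_linear (\<lambda>x :: 'n tbundle. Im (fst (fst x) $ i))"
  "bounded_linear (\<lambda>x :: 'n tbundle. Re (fst (snd x) $ i))"
  "bounded_linear (\<lambda>x :: 'n tbundle. Im (fst (snd x) $ i))"
  "bounded_linear (\<lambda>x :: 'n tbundle. snd (snd x))"
  by (intro linear_conv_bounded_linear[THEN iffD1] linearI; simp)+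

lemmas smooth_intros = smooth_add smooth_diff smooth_mult smooth_const
  bounded_linear_coords[THEN smooth_bounded_linear]

lemma smooth_energy: "smooth energy"
proof -
  have "energy = (\<lambda>x :: 'a tbundle. \<Sum>b\<in>Basis. (snd x \<bullet> b) * (1/2 * (snd x \<bullet> b)))"
    by (simp add: energy_def fun_eq_iff euclidean_inner[of _ "(_, _)"] sum_distrib_left mult_ac)
  moreover have "smooth (\<lambda>x :: 'a tbundle. \<Sum>b\<in>Basis. (snd x \<bullet> b) * (1/2 * (snd x \<bullet> b)))"
    by (intro smooth_sum smooth_mult smooth_const smooth_bounded_linear bounded_linear_inner_left_comp
        bounded_linear_snd)
  ultimately show ?thesis by (simp only:)
qed

lemma smooth_f_Z: "smooth f_Z"
  unfolding f_Z_eq[abs_def] by (intro smooth_intros)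

lemma smooth_g_A: "smooth (g_A i)"
  unfolding g_A_eq[abs_def] by (intro smooth_intros)

lemma smooth_F_T: "smooth (F_T i)"
  unfolding F_T_eq[abs_def] by (intro smooth_intros)

lemma smooth_F_X: "smooth (F_X (axis k a, 0))"
  unfolding F_X_eq[abs_def] inner_complex_def times_complex.sel imaginary_unit.sel
  by (intro smooth_intros)

section \<open>The families\<close>

lemma UNIV_fam_index: "UNIV = insert First (range Second \<union> range Third)"
  by (auto, metis fam_index.exhaust rangeI)

lemma finite_UNIV_fam_index: "finite (UNIV :: 'n::finite fam_index set)"
  unfolding UNIV_fam_index by simp

lemma sum_UNIV_fam_index:
  fixes h :: "'n::finite fam_index \<Rightarrow> 'a::comm_monoid_add"
  shows "sum h UNIV = h First + ((\<Sum>i\<in>UNIV. h (Second i)) + (\<Sum>i\<in>UNIV. h (Third i)))"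
proof -
  let ?S = "range Second :: 'n fam_index set" and ?T = "range Third :: 'n fam_index set"
  have "sum h (?S \<union> ?T) = sum h ?S + sum h ?T"
    by (rule sum.union_disjoint) auto
  moreover have "sum h ?S = (\<Sum>i\<in>UNIV. h (Second i))"
    "sum h ?T = (\<Sum>i\<in>UNIV. h (Third i))"
    by (simp_all add: sum.reindex inj_def)
  moreover have "First \<notin> ?S \<union> ?T" by auto
  moreover have "finite (?S \<union> ?T)"
    by simp
  ultimately show ?thesis unfolding UNIV_fam_index by simp
qed

lemma card_UNIV_fam_index: "card (UNIV :: 'n::finite fam_index set) = 2 * CARD('n) + 1"
  using sum_UNIV_fam_index[where 'n = 'n, of "\<lambda>_. 1::nat"]
  unfolding card_eq_sum[symmetric] by simp

lemma commuting_first_integrals_fam_G: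
  "commuting_first_integrals (energy :: 'n::finite tbundle \<Rightarrow> real) UNIV fam_G"
proof -
  have "poisson (fam_G i) (fam_G j) x = 0" for i j and x :: "'n tbundle"
    \<comment> \<open>Antisymmetry supplies the mixed brackets in the opposite order.\<close>
    using poisson_commute[OF has_gradient_energy has_gradient_g_A]
      poisson_commute[OF has_gradient_energy has_gradient_F_T]
      poisson_commute[OF has_gradient_g_A has_gradient_F_T]
    by (cases i; cases j) (simp_all add: poisson_energy_self poisson_g_A_energy poisson_F_T_energy
        poisson_g_A_g_A poisson_F_T_g_A poisson_F_T_F_T)
  moreover have "smooth (fam_G i :: 'n tbundle \<Rightarrow> real)" for i
    by (cases i) (simp_all add: smooth_energy smooth_g_A smooth_F_T)
  ultimately show ?thesis
    using fam_G.simps(1)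
    by (metis commuting_first_integrals_def commuting_family_def first_integral_def)
qed

text \<open>A common form of the odd (\<open>a = 1\<close>) and even (\<open>a = \<i>\<close>)
  families, so that both are treated at once.\<close>

primrec fam_F :: "complex \<Rightarrow> 'n::finite fam_index \<Rightarrow> 'n tbundle \<Rightarrow> real" where
  "fam_F a First = f_Z"
| "fam_F a (Second i) = g_A i"
| "fam_F a (Third k) = F_X (axis k a, 0)"

lemma fam_F_odd_eq: "fam_F_odd = fam_F 1"
proof
  show "fam_F_odd i = fam_F 1 i" for i :: "'a fam_index"
    by (cases i) (simp_all add: X_odd_def)
qed

lemma fam_F_even_eq: "fam_F_even = fam_F \<i>"
proof
  show "fam_F_even i = fam_F \<i> i" for i :: "'a fam_index"
    by (cases i) (simp_all add: X_even_def)
qed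

lemma commuting_first_integrals_fam_F:
  "commuting_first_integrals (energy :: 'n::finite tbundle \<Rightarrow> real) UNIV (fam_F a)"
proof -
  have "poisson (fam_F a i) (fam_F a j) x = 0" for i j and x :: "'n tbundle"
    using poisson_commute[OF has_gradient_g_A has_gradient_f_Z]
      poisson_commute[OF has_gradient_F_X has_gradient_f_Z]
      poisson_commute[OF has_gradient_g_A has_gradient_F_X]
    by (cases i; cases j) (simp_all add: poisson_f_Z_f_Z poisson_f_Z_g_A poisson_f_Z_F_X
        poisson_g_A_g_A poisson_F_X_g_A poisson_F_X_F_X)
  moreover have "first_integral energy (fam_F a i :: 'n tbundle \<Rightarrow> real)" for i
    by (cases i) (simp_all add: first_integral_def smooth_f_Z smooth_g_A smooth_F_X
        poisson_f_Z_energy poisson_g_A_energy poisson_F_X_energy)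
  ultimately show ?thesis
    by (simp add: commuting_first_integrals_def commuting_family_def)
qed

lemma independent_family_fam_F:
  assumes "a \<noteq> 0"
  shows "independent_family UNIV (fam_F a :: 'n::finite fam_index \<Rightarrow> 'n tbundle \<Rightarrow> real)"
proof -
  \<comment> \<open>Pairing with these vectors gives s and the real parts of the coordinates of the
    fibre vector. A nonzero real part is more than a nonzero coordinate, but it is a linear
    condition, so the generic set is a complement of hyperplanes.\<close>
  let ?B = "insert (0, (0, 1)) (range (\<lambda>i. (0, (axis i 1, 0)))) :: 'n tbundle set"
  let ?D = "{x. \<forall>b\<in>?B. b \<bullet> x \<noteq> 0}"
  have "finite ?B" by simp
  moreover have "0 \<notin> ?B" by (auto simp: prod_eq_iff)
  ultimately have D: "open ?D \<and> closure ?D = UNIV" by (rule open_dense_generic)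
  have "inj_on (\<lambda>i. gradient (fam_F a i) x) UNIV \<and>
      independent ((\<lambda>i. gradient (fam_F a i) x) ` UNIV)" if "x \<in> ?D" for x
  proof (rule independent_imageI[OF finite_UNIV_fam_index])
    have s: "snd (snd x) \<noteq> 0" using that by (simp add: inner_prod_def)
    have y: "fst (snd x) $ k \<noteq> 0" for k
    proof -
      have "(0, (axis k 1, 0)) \<in> ?B" by blast
      with that have "(0, (axis k 1, 0)) \<bullet> x \<noteq> 0" by blast
      then show ?thesis by (auto simp: inner_prod_def inner_axis')
    qed
    fix c :: "'n fam_index \<Rightarrow> real"
    assume "(\<Sum>i\<in>UNIV. c i *\<^sub>R gradient (fam_F a i) x) = 0"
    then have sum0: "c First *\<^sub>R (0, (0, 1)) +
        ((\<Sum>i\<in>UNIV. c (Second i) *\<^sub>R (0, (axis i (2 * fst (snd x) $ i), 0))) +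
         (\<Sum>k\<in>UNIV. c (Third k) *\<^sub>R ((axis k (snd (snd x) *\<^sub>R (\<i> * a)), 0),
            (axis k a, - ((\<i> * fst (fst x) $ k) \<bullet> a))))) = (0 :: 'n ttangent)"
      by (simp only: sum_UNIV_fam_index fam_F.simps gradient_eq[OF has_gradient_f_Z]
          gradient_eq[OF has_gradient_g_A] gradient_eq[OF has_gradient_F_X])
    have axis_sum: "(\<Sum>i\<in>UNIV. r i *\<^sub>R axis i (z i)) $ k = r k *\<^sub>R z k"
      for r :: "'n \<Rightarrow> real" and z :: "'n \<Rightarrow> complex" and k
      by (simp add: axis_def if_distrib[of "\<lambda>z. _ *\<^sub>R z"] cong: if_cong)
    \<comment> \<open>Only the third block has a base component; in coordinate \<open>k\<close> it
      is \<open>c (Third k)\<close> times s i a.\<close>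
    have third: "c (Third k) = 0" for k
      using arg_cong[OF sum0, of "\<lambda>\<xi>. fst (fst \<xi>) $ k"] s assms
      by (simp add: fst_sum snd_sum axis_sum del: sum_component)
    \<comment> \<open>With the third block gone, the fibre coordinate \<open>k\<close> of the
      relation is \<open>c (Second k)\<close> times twice that of the fibre vector.\<close>
    have second: "c (Second k) = 0" for k
      using arg_cong[OF sum0, of "\<lambda>\<xi>. fst (snd \<xi>) $ k"] y[of k]
      by (simp add: fst_sum snd_sum axis_sum third del: sum_component)
    have "c First = 0"
      using arg_cong[OF sum0, of "\<lambda>\<xi>. snd (snd \<xi>)"]
      by (simp add: snd_sum third)
    with second third show "\<forall>i\<in>UNIV. c i = 0"
      by (metis fam_index.exhaust)
  qed
  with D show ?thesis unfolding independent_family_def by blast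
qed

text \<open>The odd family has 2n + 1 members, the dimension of the group; a bijection
  \<open>h\<close> renumbers it by naturals.\<close>

lemma completely_integrable_energy:
  "completely_integrable (energy :: 'n::finite tbundle \<Rightarrow> real)"
proof -
  have "card (UNIV :: 'n fam_index set) = DIM('n heis)"
    by (simp add: card_UNIV_fam_index)
  then obtain h where h: "bij_betw h {..<DIM('n heis)} (UNIV :: 'n fam_index set)"
    using bij_betw_from_nat_into_finite[OF finite_UNIV_fam_index] by metis
  let ?\<phi> = "\<lambda>m. fam_F 1 (h m) :: 'n tbundle \<Rightarrow> real"
  have "commuting_first_integrals energy {..<DIM('n heis)} ?\<phi>"
    using commuting_first_integrals_fam_F[where 'n = 'n, of 1]
    by (simp add: commuting_first_integrals_def commuting_family_def)
  moreover have "independent_family {..<DIM('n heis)} ?\<phi>"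
  proof -
    have inj: "inj_on h {..<DIM('n heis)}" and img: "h ` {..<DIM('n heis)} = UNIV"
      using h by (auto simp: bij_betw_def)
    \<comment> \<open>Composing with the bijection \<open>h\<close> keeps injectivity and leaves the
      set of gradients unchanged.\<close>
    have "inj_on (\<lambda>m. gradient (?\<phi> m) x) {..<DIM('n heis)} \<and>
        independent ((\<lambda>m. gradient (?\<phi> m) x) ` {..<DIM('n heis)})"
      if "inj (\<lambda>i. gradient (fam_F 1 i) x) \<and> independent (range (\<lambda>i. gradient (fam_F 1 i) x))"
      for x :: "'n tbundle"
      using that comp_inj_on[OF inj, of "\<lambda>i. gradient (fam_F 1 i) x"] img
        image_comp[of "\<lambda>i. gradient (fam_F 1 i) x" h "{..<DIM('n heis)}"]
      by (simp add: o_def)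
    note comp = this
    obtain D where "open D" "closure D = (UNIV :: 'n tbundle set)"
      and "\<forall>x\<in>D. inj (\<lambda>i. gradient (fam_F 1 i) x) \<and>
        independent (range (\<lambda>i. gradient (fam_F 1 i) x))"
      using independent_family_fam_F[where 'n = 'n, of 1] unfolding independent_family_def by auto
    then show ?thesis
      unfolding independent_family_def using comp by blast
  qed
  ultimately show ?thesis unfolding completely_integrable_def by blast
qed

theorem theorem4p5:
  shows "completely_integrable (energy :: 'n::finite tbundle \<Rightarrow> real)
    \<and> commuting_first_integrals (energy :: 'n tbundle \<Rightarrow> real) UNIV fam_G
    \<and> (commuting_first_integrals (energy :: 'n tbundle \<Rightarrow> real) UNIV fam_F_odd
        \<and> independent_family UNIV (fam_F_odd :: 'n fam_index \<Rightarrow> 'n tbundle \<Rightarrow> real))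
    \<and> (commuting_first_integrals (energy :: 'n tbundle \<Rightarrow> real) UNIV fam_F_even
        \<and> independent_family UNIV (fam_F_even :: 'n fam_index \<Rightarrow> 'n tbundle \<Rightarrow> real))"
  unfolding fam_F_odd_eq fam_F_even_eq
  by (simp add: completely_integrable_energy commuting_first_integrals_fam_G
      commuting_first_integrals_fam_F independent_family_fam_F)

end
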